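(* Let $a,b,m\in\mathbb{Z}$ with $a\ge 2$, $m>1$, $\gcd(b,m)=1$, and $b\ge -(a-2)m-2$, and let $S=S_{a,b}(m)$. Let $n$ be the smallest positive integer such that $A_n\ge m$. Then the type of $S$ satisfies $\operatorname{t}(S)\le n-1$.
   Context: $\mathbb{N}=\{0,1,2,\dots\}$. Let $T_{a,b}(z)=az+b$, with $T_{a,b}^i$ its $i$-fold composition ($T_{a,b}^0$ the identity), and let $S_{a,b}(m)=\langle T_{a,b}^i(m)\mid i\ge 0\rangle$ be the submonoid of $(\mathbb{N},+)$ generated by the orbit of $m$; under the stated hypotheses it is a numerical semigroup (finite complement in $\mathbb{N}$) whose smallest positive element is $m$. Set $A_i=(a^i-1)/(a-1)$ for $i\ge 0$. A pseudo-Frobenius number of $S$ is an integer $x\notin S$ such that $x+s\in S$ for all $s\in S\setminus\{0\}$; the type $\operatorname{t}(S)$ is the number of pseudo-Frobenius numbers of $S$. *)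

theory Defs
  imports Main
begin

inductive_set submonoid_gen :: "'a::monoid_add set \<Rightarrow> 'a set" for X :: "'a set" where
  zero: "0 \<in> submonoid_gen X"
| gen: "x \<in> X \<Longrightarrow> x \<in> submonoid_gen X"
| add: "x \<in> submonoid_gen X \<Longrightarrow> y \<in> submonoid_gen X \<Longrightarrow> x + y \<in> submonoid_gen X"

definition T :: "int \<Rightarrow> int \<Rightarrow> int \<Rightarrow> int" where
  "T a b z = a * z + b"

(* A submonoid of the natural numbers is represented as a set of integers, since the
   generators are given by an integer formula and pseudo-Frobenius numbers range over
   the integers.  Lemma S_nonneg shows that S a b m consists of natural numbers in the
   relevant range of parameters. *)
definition S :: "int \<Rightarrow> int \<Rightarrow> int \<Rightarrow> int set" where
  "S a b m = submonoid_gen {(T a b ^^ i) m | i. True}"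

(* The division is exact for a \<noteq> 1. *)
definition A :: "int \<Rightarrow> nat \<Rightarrow> int" where
  "A a i = (a ^ i - 1) div (a - 1)"

definition pseudo_Frobenius :: "int set \<Rightarrow> int set" where
  "pseudo_Frobenius M = {x. x \<notin> M \<and> (\<forall>s \<in> M - {0}. x + s \<in> M)}"

(* The cardinality is taken of a finite set: see finite_pseudo_Frobenius_S. *)
definition semigroup_type :: "int set \<Rightarrow> nat" where
  "semigroup_type M = card (pseudo_Frobenius M)"

lemma S_nonneg:
  assumes "a \<ge> 2" "m > 1" "b \<ge> - (a - 2) * m - 2" "x \<in> S a b m"
  shows "x \<ge> 0"
proof -
  have orbit: "(T a b ^^ i) m \<ge> m" for i
  proof (induction i)
    case (Suc i)
    have "a * (T a b ^^ i) m \<ge> a * m"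
      using Suc assms(1) by (intro mult_left_mono) auto
    moreover have "a * m + b \<ge> m"
      using assms(2,3) by (simp add: algebra_simps)
    moreover have "(T a b ^^ Suc i) m = a * (T a b ^^ i) m + b"
      by (simp add: T_def [of _ _ "(T a b ^^ i) m"])
    ultimately show ?case by linarith
  qed simp
  show ?thesis
    using assms(4) unfolding S_def
  proof (induction rule: submonoid_gen.induct)
    case (gen x)
    then obtain i where "x = (T a b ^^ i) m" by blast
    then show ?case using orbit[of i] assms(2) by simp
  qed auto
qed

lemma finite_pseudo_Frobenius_S:
  assumes "m > 0"
  shows "finite (pseudo_Frobenius (S a b m))"
proof -
  have "m \<in> {(T a b ^^ i) m | i. True}"
    by (force intro: exI[of _ 0])
  then have m: "m \<in> S a b m"
    unfolding S_def by (rule submonoid_gen.gen)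
  have add: "x + y \<in> S a b m" if "x \<in> S a b m" "y \<in> S a b m" for x y
    using that unfolding S_def by (rule submonoid_gen.add)
  have mult: "x + int k * m \<in> S a b m" if "x \<in> S a b m" for x k
  proof (induction k)
    case (Suc k)
    from add[OF this m] show ?case by (simp add: algebra_simps)
  qed (use that in simp)
  have less: False
    if "x \<in> pseudo_Frobenius (S a b m)" "y \<in> pseudo_Frobenius (S a b m)"
      "x mod m = y mod m" "x < y" for x y
  proof -
    from that(3) have "m dvd y - x" by (metis mod_eq_dvd_iff)
    then obtain c where c: "y - x = m * c" by blast
    with that(4) assms have "c > 0" by (metis diff_gt_0_iff_gt zero_less_mult_pos)
    have "x + m \<in> S a b m"
      using that(1) m assms by (auto simp: pseudo_Frobenius_def)
    from mult[OF this, of "nat (c - 1)"] have "y \<in> S a b m"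
      using c \<open>c > 0\<close> by (simp add: algebra_simps)
    with that(2) show False by (simp add: pseudo_Frobenius_def)
  qed
  have "inj_on (\<lambda>x. x mod m) (pseudo_Frobenius (S a b m))"
    by (rule inj_onI) (metis less linorder_neqE)
  moreover have "(\<lambda>x. x mod m) ` pseudo_Frobenius (S a b m) \<subseteq> {0..<m}"
    using assms by auto
  ultimately show ?thesis
    by (meson finite_atLeastLessThan_int finite_imageD finite_subset)
qed

end

theory Submission imports Defs begin

text \<open>
  Put c = (a - 1) m + b, so that the i-th orbit element is m + A_i c.  Writing L(s) for the least
  number of summands A_i (i > 0) with sum s, the semigroup consists of the numbers k m + s c with
  k \<ge> L(s).  The bound on b says c \<ge> m - 2; this makes L(r) m + r c, for 0 \<le> r < m, the
  Apery set of m.  Hence a pseudo-Frobenius number has the form (L(r) - 1) m + r c where r > 0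
  cannot be extended: L(r + A_i) \<le> L(r) whenever r + A_i < m.

  Let P move every digit of a greedy expansion up one place, sending A_i to A_(i+1).  Then
  P(t) = a t + L(t) and L(P(t)) = L(t), and L(s + 1) = L(s) + 1 unless s + 1 is a value of P, in
  which case L drops by a - 1.  So an r below m - 1 that cannot be extended is P(t) - 1 for some t,
  and t again cannot be extended, with respect to the number k of arguments at which P is below m.
  As m \<le> A_(n+1) implies k \<le> A_n, induction gives at most n - 1 such r when m \<le> A_n.
\<close>

section \<open>Repunits, the digit shift and the digit sum\<close>

fun repunit :: "nat \<Rightarrow> nat \<Rightarrow> nat" where
  "repunit q 0 = 0"
| "repunit q (Suc i) = q * repunit q i + 1"

text \<open>
  The digit shift P and the digit sum L are defined together through P alone: since
  P(t) = q t + L(t), the increment of P is q + 1 where L grows by one and 1 where L drops.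
\<close>

function shift :: "nat \<Rightarrow> nat \<Rightarrow> nat" where
  "shift q 0 = 0"
| "shift q (Suc t) = shift q t + (if \<exists>u\<in>{..t}. shift q u = Suc t then 1 else q + 1)"
  by pat_completeness auto
termination by (relation "measure snd") auto

declare shift.simps(2) [simp del]

text \<open>Integer-valued, since nonnegativity becomes available only through
  \<open>digit_sum_representation\<close>.\<close>

definition digit_sum :: "nat \<Rightarrow> nat \<Rightarrow> int" where
  "digit_sum q t = int (shift q t) - int q * int t"

lemma strict_mono_shift: "strict_mono (shift q)"
  by (simp add: strict_mono_Suc_iff shift.simps(2))

lemma shift_ge: "t \<le> shift q t"
  using strict_mono_imp_increasing[OF strict_mono_shift] .

lemma shift_gt:
  assumes "q > 0" "t > 0" shows "t < shift q t"
proof -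
  have "Suc t < shift q (Suc t)" for t
    using assms(1) by (induction t) (auto simp: shift.simps(2))
  with assms(2) show ?thesis by (cases t) auto
qed

text \<open>Positive arguments move strictly up, so any preimage of \<open>Suc t\<close> is at most
  \<open>t\<close>, and the bounded search in the recursion sees the whole range.\<close>

lemma shift_Suc:
  assumes "q > 0"
  shows "shift q (Suc t) = shift q t + (if Suc t \<in> range (shift q) then 1 else q + 1)"
proof -
  have "(\<exists>u\<in>{..t}. shift q u = Suc t) \<longleftrightarrow> Suc t \<in> range (shift q)"
  proof
    assume "Suc t \<in> range (shift q)"
    then obtain u where u: "shift q u = Suc t" by auto
    moreover from this have "u > 0" by (cases u) auto
    ultimately show "\<exists>u\<in>{..t}. shift q u = Suc t"
      using shift_gt[OF assms, of u] by auto
  qed (metis rangeI)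
  then show ?thesis by (simp add: shift.simps(2))
qed

lemma shift_eq: "int (shift q t) = int q * int t + digit_sum q t"
  by (simp add: digit_sum_def)

lemma digit_sum_0 [simp]: "digit_sum q 0 = 0"
  by (simp add: digit_sum_def)

lemma digit_sum_Suc:
  assumes "q > 0"
  shows "digit_sum q (Suc t) = digit_sum q t + (if Suc t \<in> range (shift q) then 1 - int q else 1)"
  by (simp add: digit_sum_def shift_Suc[OF assms] algebra_simps)

lemma digit_sum_add_le:
  assumes "q > 0"
  shows "digit_sum q (t + e) \<le> digit_sum q t + int e"
proof (induction e)
  case (Suc e)
  with digit_sum_Suc[OF assms, of "t + e"] assms show ?case by (auto split: if_splits)
qed simp

lemma digit_sum_le: "q > 0 \<Longrightarrow> digit_sum q t \<le> int t"
  using digit_sum_add_le[of q 0 t] by simp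

text \<open>No value of \<open>shift q\<close> lies strictly between consecutive ones, so no drop
  occurs there.\<close>

lemma digit_sum_add_eq:
  assumes "q > 0" "shift q t + e < shift q (Suc t)"
  shows "digit_sum q (shift q t + e) = digit_sum q (shift q t) + int e"
  using assms(2)
proof (induction e)
  case (Suc e)
  have "Suc (shift q t + e) \<notin> range (shift q)"
  proof
    assume "Suc (shift q t + e) \<in> range (shift q)"
    then obtain u where "shift q u = Suc (shift q t + e)" by auto
    with Suc.prems have "shift q t < shift q u" "shift q u < shift q (Suc t)" by auto
    then show False by (simp add: strict_mono_less[OF strict_mono_shift])
  qed
  with Suc digit_sum_Suc[OF assms(1), of "shift q t + e"] show ?case by simp
qed simp

text \<open>From one value of \<open>shift q\<close> to the next, the digit sum changes by the gap
  minus \<open>q\<close>; by \<open>shift_eq\<close> this is also its change from \<open>t\<close>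
  to \<open>Suc t\<close>.\<close>

lemma digit_sum_shift:
  assumes "q > 0"
  shows "digit_sum q (shift q t) = digit_sum q t"
proof (induction t)
  case (Suc t)
  define e where "e = shift q (Suc t) - shift q t - 1"
  have "shift q t < shift q (Suc t)" by (simp add: strict_mono_less[OF strict_mono_shift])
  then have e: "shift q (Suc t) = Suc (shift q t + e)" by (simp add: e_def)
  then have "Suc (shift q t + e) \<in> range (shift q)" by (metis rangeI)
  with digit_sum_Suc[OF assms, of "shift q t + e"] digit_sum_add_eq[OF assms, of t e] Suc e
  have "digit_sum q (shift q (Suc t)) = digit_sum q t + int (Suc e) - int q" by simp
  also have "int (Suc e) = int (shift q (Suc t)) - int (shift q t)" using e by simp
  also have "digit_sum q t + \<dots> - int q = digit_sum q (Suc t)"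
    by (simp add: digit_sum_def algebra_simps)
  finally show ?case .
qed simp

lemma digit_sum_pred_shift:
  assumes "q > 0" "shift q t = Suc s"
  shows "digit_sum q s = digit_sum q t + int q - 1"
proof -
  have "Suc s \<in> range (shift q)" by (metis assms(2) rangeI)
  with digit_sum_Suc[OF assms(1), of s] digit_sum_shift[OF assms(1), of t] assms(2)
  show ?thesis by simp
qed

text \<open>In terms of greedy expansions, \<open>e\<close> is the lowest digit of \<open>s\<close>,
  and \<open>t\<close> is the rest moved down one place.\<close>

lemma shift_decomp:
  obtains t e where "s = shift q t + e" "s < shift q (Suc t)"
proof -
  have "\<exists>t e. s = shift q t + e \<and> s < shift q (Suc t)"
  proof (induction s)
    case 0
    have "shift q 0 < shift q (Suc 0)" by (simp only: strict_mono_less[OF strict_mono_shift])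
    then show ?case by (intro exI[of _ 0]) auto
  next
    case (Suc s)
    then obtain t e where te: "s = shift q t + e" "s < shift q (Suc t)" by auto
    show ?case
    proof (cases "Suc s < shift q (Suc t)")
      case True
      with te show ?thesis by (intro exI[of _ t] exI[of _ "Suc e"]) auto
    next
      case False
      with te have "Suc s = shift q (Suc t) + 0" by simp
      moreover have "shift q (Suc t) < shift q (Suc (Suc t))"
        by (simp only: strict_mono_less[OF strict_mono_shift])
      ultimately show ?thesis by fastforce
    qed
  qed
  with that show ?thesis by blast
qed

lemma digit_sum_decomp:
  assumes "q > 0" "s = shift q t + e" "s < shift q (Suc t)"
  shows "digit_sum q s = digit_sum q t + int e"
  using digit_sum_add_eq[of q t e] digit_sum_shift[of q t] assms by simp

section \<open>Comparison with arbitrary sums of repunits\<close>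

lemma digit_sum_add_repunit_le:
  assumes "q > 0"
  shows "digit_sum q (s + repunit q i) \<le> digit_sum q s + 1"
proof (induction i arbitrary: s)
  case (Suc i)
  obtain t e where te: "s = shift q t + e" "s < shift q (Suc t)" by (rule shift_decomp)
  \<comment> \<open>The slack \<open>f\<close>, nonnegative by the induction hypothesis, is chosen
    so that \<open>s + repunit q (Suc i)\<close> equals
    \<open>shift q (t + repunit q i) + (e + f)\<close>; each of the last \<open>e + f\<close> unit
    steps adds at most one digit.\<close>
  define f where "f = nat (digit_sum q t + 1 - digit_sum q (t + repunit q i))"
  have f: "int f = digit_sum q t + 1 - digit_sum q (t + repunit q i)"
    using Suc[of t] by (simp add: f_def)
  have "int (s + repunit q (Suc i)) = int (shift q (t + repunit q i) + (e + f))"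
    by (simp add: te(1) shift_eq f algebra_simps)
  then have "s + repunit q (Suc i) = shift q (t + repunit q i) + (e + f)" by (simp only: of_nat_eq_iff)
  then have "digit_sum q (s + repunit q (Suc i))
      \<le> digit_sum q (shift q (t + repunit q i)) + int (e + f)"
    using digit_sum_add_le[OF assms, of "shift q (t + repunit q i)" "e + f"] by (simp only:)
  with f digit_sum_shift[OF assms] digit_sum_decomp[OF assms te] show ?case by simp
qed simp

lemma sum_list_repunit_Suc:
  "sum_list (map (repunit q) (map Suc is)) = q * sum_list (map (repunit q) is) + length is"
  by (induction "is") (auto simp: algebra_simps)

lemma digit_sum_representation:
  assumes "q > 0"
  shows "\<exists>is. sum_list (map (repunit q) is) = s \<and> int (length is) = digit_sum q s"
proof (induction s rule: less_induct)
  case (less s)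
  show ?case
  proof (cases "s = 0")
    case False
    obtain t e where te: "s = shift q t + e" "s < shift q (Suc t)" by (rule shift_decomp)
    have "t < s" using shift_gt[OF assms, of t] te False by (cases "t = 0") auto
    with less obtain js where js: "sum_list (map (repunit q) js) = t"
      "int (length js) = digit_sum q t" by blast
    \<comment> \<open>Raising every index turns the sum \<open>t\<close> into
      \<open>q * t + length js\<close>, which is \<open>shift q t\<close>; the \<open>e\<close> ones
      supply the rest.\<close>
    let ?is = "map Suc js @ replicate e 1"
    have "int (sum_list (map (repunit q) ?is)) = int s"
      unfolding map_append sum_list_append sum_list_repunit_Suc
      using js te by (simp add: shift_eq sum_list_replicate)
    moreover have "int (length ?is) = digit_sum q s"
      using js digit_sum_decomp[OF assms te] by simp
    ultimately show ?thesis by (metis of_nat_eq_iff)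
  qed simp
qed

lemma digit_sum_nonneg: "q > 0 \<Longrightarrow> digit_sum q s \<ge> 0"
  using digit_sum_representation[of q s] by auto

lemma digit_sum_pos:
  assumes "q > 0" "s > 0" shows "digit_sum q s > 0"
proof (rule ccontr)
  assume "\<not> digit_sum q s > 0"
  moreover obtain "is" where "is": "sum_list (map (repunit q) is) = s"
    "int (length is) = digit_sum q s"
    using digit_sum_representation[OF assms(1)] by blast
  ultimately have "is = []" by (metis length_greater_0_conv of_nat_0_less_iff)
  with "is" assms(2) show False by simp
qed

text \<open>At \<open>s = 0\<close>, together with \<open>digit_sum_representation\<close>, this
  identifies \<open>digit_sum\<close> as the least number of repunits with a given sum.\<close>

lemma digit_sum_add_sum_list_le:
  assumes "q > 0"
  shows "digit_sum q (s + sum_list (map (repunit q) is)) \<le> digit_sum q s + int (length is)"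
proof (induction "is" arbitrary: s)
  case (Cons i "is")
  show ?case
    using Cons[of "s + repunit q i"] digit_sum_add_repunit_le[OF assms, of s i]
    by (simp add: algebra_simps)
qed simp

lemma digit_sum_subadditive:
  assumes "q > 0"
  shows "digit_sum q (s + t) \<le> digit_sum q s + digit_sum q t"
  by (metis assms digit_sum_representation digit_sum_add_sum_list_le)

text \<open>Proved jointly: digit sum 1 determines the next shift, and
  \<open>digit_sum_shift\<close> carries the 1 along. The start is that 1 is not a value of
  \<open>shift q\<close>.\<close>

lemma shift_repunit: "q > 0 \<Longrightarrow> i > 0 \<Longrightarrow> shift q (repunit q i) = repunit q (Suc i)"
  and digit_sum_repunit: "q > 0 \<Longrightarrow> i > 0 \<Longrightarrow> digit_sum q (repunit q i) = 1"
proof -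
  have *: "digit_sum q (repunit q (Suc i)) = 1 \<and> shift q (repunit q (Suc i)) = repunit q (Suc (Suc i))"
    if "q > 0" for i
  proof (induction i)
    case 0
    have "1 \<notin> range (shift q)"
    proof
      assume "1 \<in> range (shift q)"
      then obtain u where "shift q u = 1" by auto
      with shift_gt[OF that, of u] show False by (cases u) auto
    qed
    then show ?case using that by (simp add: digit_sum_Suc shift_Suc)
  next
    case (Suc i)
    then have d: "digit_sum q (repunit q (Suc (Suc i))) = 1"
      using digit_sum_shift[OF that] by metis
    then have "int (shift q (repunit q (Suc (Suc i)))) = int (repunit q (Suc (Suc (Suc i))))"
      unfolding shift_eq d by (simp add: algebra_simps)
    with d show ?case by (simp only: of_nat_eq_iff)
  qed
  show "q > 0 \<Longrightarrow> i > 0 \<Longrightarrow> shift q (repunit q i) = repunit q (Suc i)"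
    "q > 0 \<Longrightarrow> i > 0 \<Longrightarrow> digit_sum q (repunit q i) = 1"
    using *[of "i - 1"] by auto
qed

section \<open>Counting the residues that cannot be extended\<close>

text \<open>The residue 0 is excluded so that the bound below also holds for m = 1.\<close>

definition maximal_residues :: "nat \<Rightarrow> nat \<Rightarrow> nat set" where
  "maximal_residues q m = {r. 0 < r \<and> r < m \<and>
     (\<forall>i>0. r + repunit q i < m \<longrightarrow> digit_sum q (r + repunit q i) \<le> digit_sum q r)}"

lemma maximal_residues_descent:
  assumes q: "q > 0" and r: "r \<in> maximal_residues q m" "Suc r \<noteq> m"
    and k: "\<And>u. shift q u < m \<longleftrightarrow> u < k"
  shows "\<exists>t \<in> maximal_residues q k. r = shift q t - 1"
proof -
  have rm: "Suc r < m" and max: "\<And>i. i > 0 \<Longrightarrow> r + repunit q i < m \<Longrightarrow>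
      digit_sum q (r + repunit q i) \<le> digit_sum q r"
    using r by (auto simp: maximal_residues_def)
  from max[of 1] rm have "digit_sum q (Suc r) \<le> digit_sum q r" by simp
  then have "Suc r \<in> range (shift q)"
    by (simp add: digit_sum_Suc[OF q] split: if_splits)
  then obtain t where t: "shift q t = Suc r" by auto
  have "t > 0" using t by (cases t) auto
  moreover have "t < k" using k t rm by metis
  moreover have "digit_sum q (t + repunit q i) \<le> digit_sum q t"
    if "i > 0" "t + repunit q i < k" for i
  proof (rule ccontr)
    let ?u = "t + repunit q i"
    assume "\<not> digit_sum q ?u \<le> digit_sum q t"
    then have du: "digit_sum q ?u = digit_sum q t + 1"
      using digit_sum_add_repunit_le[OF q, of t i] by simp
    let ?s = "r + repunit q (Suc i)"
    \<comment> \<open>The one extra digit makes \<open>shift q ?u\<close> equal to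
      \<open>shift q t + repunit q (Suc i)\<close>, so an extension of \<open>t\<close> would yield
      one of \<open>r\<close>.\<close>
    have "int (shift q ?u) = int (Suc ?s)"
      using t[THEN arg_cong, of int] unfolding shift_eq du by (simp add: algebra_simps)
    then have s: "shift q ?u = Suc ?s" by (simp only: of_nat_eq_iff)
    with k[of ?u] that have "?s < m" by simp
    then have "digit_sum q ?s \<le> digit_sum q r" by (intro max) auto
    moreover have "digit_sum q ?s = digit_sum q ?u + int q - 1"
      using digit_sum_pred_shift[OF q s] .
    moreover have "digit_sum q r = digit_sum q t + int q - 1"
      using digit_sum_pred_shift[OF q t] .
    ultimately show False using du by simp
  qed
  ultimately have "t \<in> maximal_residues q k" by (auto simp: maximal_residues_def)
  with t show ?thesis by force
qed

lemma finite_maximal_residues: "finite (maximal_residues q m)"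
  by (rule finite_subset[of _ "{..<m}"]) (auto simp: maximal_residues_def)

text \<open>The descent accounts for every residue but \<open>m - 1\<close>, so each round costs at
  most one; for \<open>n = 0\<close> the bound \<open>m \<le> 1\<close> leaves no positive
  residue.\<close>

lemma card_maximal_residues:
  assumes "q > 0" "m \<le> repunit q (Suc n)"
  shows "card (maximal_residues q m) \<le> n"
  using assms(2)
proof (induction n arbitrary: m)
  case 0
  then have "maximal_residues q m = {}" by (auto simp: maximal_residues_def)
  then show ?case by simp
next
  case (Suc n)
  define k where "k = (LEAST u. m \<le> shift q u)"
  have "m \<le> shift q k" unfolding k_def by (rule LeastI[of _ m]) (rule shift_ge)
  then have k: "shift q u < m \<longleftrightarrow> u < k" for u
    by (metis k_def not_less_Least not_less strict_mono_less_eq[OF strict_mono_shift] le_trans)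
  have "m \<le> shift q (repunit q (Suc n))"
    using Suc.prems shift_repunit[OF assms(1), of "Suc n"] by simp
  then have "k \<le> repunit q (Suc n)" unfolding k_def by (rule Least_le)
  then have IH: "card (maximal_residues q k) \<le> n" by (rule Suc.IH)
  have "maximal_residues q m \<subseteq> insert (m - 1) ((\<lambda>t. shift q t - 1) ` maximal_residues q k)"
    using maximal_residues_descent[OF assms(1) _ _ k] by force
  then have "card (maximal_residues q m) \<le>
      card (insert (m - 1) ((\<lambda>t. shift q t - 1) ` maximal_residues q k))"
    by (intro card_mono) (auto simp: finite_maximal_residues)
  also have "\<dots> \<le> Suc (card (maximal_residues q k))"
    using card_image_le[OF finite_maximal_residues, of "\<lambda>t. shift q t - 1" q k]
    by (simp add: card_insert_if finite_maximal_residues)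
  finally show ?case using IH by simp
qed

section \<open>The semigroup and its pseudo-Frobenius numbers\<close>

lemma A_eq_repunit:
  assumes "q \<ge> 2" shows "A (int q) i = int (repunit q i)"
proof -
  have "int q ^ i - 1 = (int q - 1) * int (repunit q i)"
  proof (induction i)
    case (Suc i)
    have "int q ^ Suc i - 1 = int q * (int q ^ i - 1) + (int q - 1)" by (simp add: algebra_simps)
    also have "\<dots> = (int q - 1) * int (repunit q (Suc i))"
      unfolding Suc by (simp add: algebra_simps)
    finally show ?case .
  qed simp
  with assms show ?thesis by (simp add: A_def)
qed

lemma T_funpow: "(T (int q) b ^^ i) m = m + int (repunit q i) * ((int q - 1) * m + b)"
proof (induction i)
  case (Suc i)
  have "(T (int q) b ^^ Suc i) m = int q * (T (int q) b ^^ i) m + b"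
    by (simp add: T_def[of _ _ "(T (int q) b ^^ i) m"])
  then show ?case unfolding Suc by (simp add: algebra_simps)
qed simp

text \<open>\<open>k\<close> counts the generators used and \<open>s\<close> is the sum of their
  repunits; subadditivity of the digit sum gives closure under addition.\<close>

lemma S_eq:
  assumes "q > 0"
  shows "S (int q) b m = {int k * m + int s * ((int q - 1) * m + b) | k s. digit_sum q s \<le> int k}"
    (is "_ = ?R")
proof
  let ?c = "(int q - 1) * m + b"
  show "S (int q) b m \<subseteq> ?R"
  proof
    fix x assume "x \<in> S (int q) b m"
    then show "x \<in> ?R" unfolding S_def
    proof induction
      case zero
      show ?case by (rule CollectI, rule exI[of _ 0], rule exI[of _ 0]) simp
    next
      case (gen x)
      then obtain i where "x = int 1 * m + int (repunit q i) * ?c" by (auto simp: T_funpow)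
      moreover have "digit_sum q (repunit q i) \<le> int 1"
        using digit_sum_add_repunit_le[OF assms, of 0 i] by simp
      ultimately show ?case by blast
    next
      case (add x y)
      then obtain k s l t where "x = int k * m + int s * ?c" "digit_sum q s \<le> int k"
        "y = int l * m + int t * ?c" "digit_sum q t \<le> int l" by blast
      with digit_sum_subadditive[OF assms, of s t]
      have "x + y = int (k + l) * m + int (s + t) * ?c" "digit_sum q (s + t) \<le> int (k + l)"
        by (simp_all add: algebra_simps)
      then show ?case by blast
    qed
  qed
  show "?R \<subseteq> S (int q) b m"
  proof
    fix x assume "x \<in> ?R"
    then obtain k s where x: "x = int k * m + int s * ?c" and k: "digit_sum q s \<le> int k" by blast
    obtain js where js: "sum_list (map (repunit q) js) = s" "int (length js) = digit_sum q s"
      using digit_sum_representation[OF assms] by blast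
    \<comment> \<open>Index 0 stands for the generator \<open>m\<close>, so the padding brings the
      number of generators to \<open>k\<close> and keeps the sum \<open>s\<close>.\<close>
    let ?is = "js @ replicate (k - length js) 0"
    have gen: "m + int (repunit q i) * ?c \<in> S (int q) b m" for i
      unfolding S_def by (rule submonoid_gen.gen) (auto simp: T_funpow)
    have sum: "int (length is) * m + int (sum_list (map (repunit q) is)) * ?c \<in> S (int q) b m" for "is"
    proof (induction "is")
      case Nil
      show ?case by (simp add: S_def submonoid_gen.zero)
    next
      case (Cons i "is")
      from submonoid_gen.add[OF gen[of i, unfolded S_def] Cons[unfolded S_def]]
      show ?case by (simp add: S_def algebra_simps)
    qed
    have "length ?is = k" "sum_list (map (repunit q) ?is) = s"
      using js k by (auto simp: sum_list_replicate)
    with sum[of ?is] x show "x \<in> S (int q) b m" by (simp only:)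
  qed
qed

lemma pseudo_Frobenius_S_subset:
  fixes b m :: int
  assumes q: "q > 0" and m: "m > 1" and gcd: "gcd b m = 1" and b: "b \<ge> - (int q - 2) * m - 2"
  shows "pseudo_Frobenius (S (int q) b m) \<subseteq>
    (\<lambda>r. (digit_sum q r - 1) * m + int r * ((int q - 1) * m + b)) ` maximal_residues q (nat m)"
proof
  define c where "c = (int q - 1) * m + b"
  have c: "c \<ge> m - 2" using b by (simp add: c_def algebra_simps)
  have "gcd c m = 1" using gcd unfolding c_def
    by (metis gcd.commute gcd_add_mult)
  then have cop: "coprime m c" by (simp add: coprime_iff_gcd_eq_1 gcd.commute)
  \<comment> \<open>The bound \<open>c \<ge> m - 2\<close> leaves only \<open>c = 0\<close> with
    \<open>m = 2\<close> to exclude, which coprimality does.\<close>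
  have cpos: "c > 0"
  proof (rule ccontr)
    assume "\<not> c > 0"
    with c m have "c = 0" "m = 2" by auto
    with cop show False by simp
  qed
  have memI: "k * m + int s * c \<in> S (int q) b m" if "digit_sum q s \<le> k" for k s
  proof -
    have "k = int (nat k)" using that digit_sum_nonneg[OF q, of s] by simp
    with that show ?thesis unfolding S_eq[OF q] c_def
      by (intro CollectI exI[of _ "nat k"] exI[of _ s]) auto
  qed
  fix x assume "x \<in> pseudo_Frobenius (S (int q) b m)"
  then have xS: "x \<notin> S (int q) b m"
    and PF: "\<And>s. s \<in> S (int q) b m \<Longrightarrow> s \<noteq> 0 \<Longrightarrow> x + s \<in> S (int q) b m"
    by (auto simp: pseudo_Frobenius_def)
  have "m \<in> S (int q) b m" using memI[of 0 1] by simp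
  then have "x + m \<in> S (int q) b m" using PF m by simp
  then obtain k s where ks: "x + m = int k * m + int s * c" "digit_sum q s \<le> int k"
    unfolding S_eq[OF q] c_def by blast
  define r j where "r = s mod nat m" and "j = s div nat m"
  have rm: "r < nat m" using m by (simp add: r_def)
  have s: "int s = int j * m + int r"
    using m by (simp add: r_def j_def flip: of_nat_mult of_nat_add)
      (metis div_mult_mod_eq int_nat_eq of_nat_add of_nat_mult less_imp_le less_trans zero_less_one)
  \<comment> \<open>Reducing \<open>s\<close> modulo \<open>m\<close> moves \<open>j * c\<close>
    into the coefficient of \<open>m\<close>, because
    \<open>s * c = (j * c) * m + r * c\<close>.\<close>
  define K where "K = int k + int j * c"
  have x: "x = (K - 1) * m + int r * c"
    using ks(1) s by (simp add: K_def algebra_simps)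
  have "digit_sum q r \<le> K"
  proof (cases "j = 0")
    case True
    with s have "s = r" by simp
    with ks True show ?thesis by (simp add: K_def)
  next
    \<comment> \<open>For \<open>j \<ge> 1\<close> the bound on \<open>b\<close> gives
      \<open>K \<ge> 1 + c \<ge> m - 1 \<ge> r\<close>, and \<open>r\<close> bounds its own digit
      sum.\<close>
    case False
    with s m have "s > 0" by (cases s) (auto simp: add_nonneg_eq_0_iff)
    then have "int k \<ge> 1" using digit_sum_pos[OF q, of s] ks(2) by linarith
    moreover have "int j * c \<ge> 1 * c" using False cpos by (intro mult_right_mono) auto
    ultimately show ?thesis using c rm digit_sum_le[OF q, of r] unfolding K_def by linarith
  qed
  moreover have "\<not> digit_sum q r \<le> K - 1" using memI[of r "K - 1"] xS x by auto
  ultimately have K: "K = digit_sum q r" by simp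
  have max: "digit_sum q (r + repunit q i) \<le> digit_sum q r"
    if i: "i > 0" "r + repunit q i < nat m" for i
  proof -
    let ?A = "repunit q i"
    have A: "?A > 0" using i by (cases i) auto
    have "m + int ?A * c \<in> S (int q) b m"
      using memI[of ?A 1] digit_sum_repunit[OF q i(1)] by simp
    moreover have "m + int ?A * c > 0" using m cpos by (simp add: add_pos_nonneg)
    ultimately have "x + (m + int ?A * c) \<in> S (int q) b m" using PF by simp
    then obtain l t where lt: "x + (m + int ?A * c) = int l * m + int t * c" "digit_sum q t \<le> int l"
      unfolding S_eq[OF q] c_def by blast
    then have eq: "(K - int l) * m = (int t - int (r + ?A)) * c"
      unfolding x by (simp add: algebra_simps)
    then have "m dvd (int t - int (r + ?A)) * c" by (metis dvd_triv_right)
    then have "m dvd int t - int (r + ?A)" using cop by (simp add: coprime_dvd_mult_left_iff)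
    then obtain j where j: "int t - int (r + ?A) = m * j" by blast
    \<comment> \<open>Together with \<open>t \<ge> 0\<close> this rules out negative
      \<open>j\<close>.\<close>
    have "int (r + ?A) < m" using i m by linarith
    then have "m * j > m * (- 1)" using j by linarith
    then have "j > - 1" using m mult_less_cancel_left_pos[of m "- 1" j] by simp
    then have "j \<ge> 0" by simp
    have "(K - int l) * m = (j * c) * m" using eq j by (simp add: algebra_simps)
    then have Kl: "K - int l = j * c" using m by simp
    show ?thesis
    proof (cases "j = 0")
      case True
      then have "t = r + ?A" "K = int l" using j Kl by auto
      with lt K show ?thesis by simp
    next
      \<comment> \<open>Contradiction: \<open>K = l + j * c \<ge> m - 1\<close>, whereas
        \<open>K \<le> r < m - 1\<close>.\<close>
      case False
      with \<open>j \<ge> 0\<close> have "j * c \<ge> 1 * c" using cpos by (intro mult_right_mono) auto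
      moreover have "t > 0" using j \<open>j \<ge> 0\<close> A m
        using mult_nonneg_nonneg[of m j] by linarith
      then have "int l \<ge> 1" using digit_sum_pos[OF q, of t] lt(2) by linarith
      ultimately have "K \<ge> m - 1" using Kl c by linarith
      with K digit_sum_le[OF q, of r] i A show ?thesis by linarith
    qed
  qed
  have "r > 0"
  proof (rule ccontr)
    assume "\<not> r > 0"
    with max[of 1] m digit_sum_repunit[OF q, of 1] show False by simp
  qed
  with rm max have "r \<in> maximal_residues q (nat m)" by (auto simp: maximal_residues_def)
  with x K show "x \<in> (\<lambda>r. (digit_sum q r - 1) * m + int r * ((int q - 1) * m + b))
      ` maximal_residues q (nat m)" by (auto simp: c_def)
qed

theorem theorem7p1:
  fixes a b m :: int and n :: nat
  assumes "a \<ge> 2" and "m > 1" and "gcd b m = 1" and "b \<ge> - (a - 2) * m - 2"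
    and "n = (LEAST k. k > 0 \<and> A a k \<ge> m)"
  shows "semigroup_type (S a b m) \<le> n - 1"
proof -
  define q where "q = nat a"
  have a: "a = int q" and q: "q \<ge> 2" using assms(1) by (auto simp: q_def)
  \<comment> \<open>This makes \<open>m\<close> itself a candidate for \<open>k\<close>, so the
    minimum defining \<open>n\<close> is attained.\<close>
  have ge: "i \<le> repunit q i" for i
  proof (induction i)
    case (Suc i)
    have "1 * repunit q i \<le> q * repunit q i" using q by (intro mult_right_mono) auto
    with Suc show ?case unfolding repunit.simps by linarith
  qed simp
  have "nat m > 0 \<and> A a (nat m) \<ge> m"
    using assms(2) ge[of "nat m"] by (simp add: a A_eq_repunit[OF q] nat_le_iff)
  then have n: "n > 0 \<and> A a n \<ge> m" unfolding assms(5) by (rule LeastI)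
  then have "nat m \<le> repunit q (Suc (n - 1))"
    by (simp add: a A_eq_repunit[OF q] nat_le_iff)
  then have "card (maximal_residues q (nat m)) \<le> n - 1"
    using q by (intro card_maximal_residues) auto
  moreover have "semigroup_type (S a b m) \<le> card (maximal_residues q (nat m))"
    unfolding semigroup_type_def a
    by (rule surj_card_le[OF finite_maximal_residues pseudo_Frobenius_S_subset])
      (use q assms a in auto)
  ultimately show ?thesis by simp
qed

end
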